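(* Let $(x^k,u^k)_{k\ge0}$ be generated by Algorithm (DG) and let $\hat u^k = \frac{1}{S_k}\sum_{j=0}^k\alpha_j u^j$ with $S_k=\sum_{j=0}^k\alpha_j$. Then the average primal iterate $\hat u^k$ is an $\epsilon$-primal solution of (P) after $k=\mathcal{O}(1/\epsilon)$ iterations; that is, there exist constants $C_1,C_2>0$, independent of $\epsilon$ and $k$, such that for every $\epsilon>0$ and every integer $k \ge C_1/\epsilon$, $$\mathrm{dist}_{\mathcal{K}}(G\hat u^k+g)\le C_2\,\epsilon \quad\text{and}\quad -C_2\,\epsilon\le f(\hat u^k)-f^*\le C_2\,\epsilon .$$
   Context: Problem (P): $f^* = \min_{u \in U} f(u)$ subject to $Gu + g \in \mathcal{K}$, where $f:\mathbb{R}^n \to \mathbb{R}$ is $\sigma_{\mathrm f}$-strongly convex with respect to the Euclidean norm $\|\cdot\|$ ($\sigma_{\mathrm f}>0$), $G \in \mathbb{R}^{p\times n}$ ($G\ne 0$), $g \in \mathbb{R}^p$, $\mathcal{K}\subseteq\mathbb{R}^p$ is a proper cone (closed, convex, pointed, nonempty interior), and $U \subseteq \mathbb{R}^n$ is a nonempty closed convex set. $\mathcal{K}^* = \{x : \langle x,z\rangle \ge 0\ \forall z\in\mathcal{K}\}$ is the dual cone. The Lagrangian is $\mathcal{L}(u,x) = f(u) - \langle x, Gu+g\rangle$, the dual function is $d(x) = \min_{u\in U}\mathcal{L}(u,x)$ for $x \in \mathbb{R}^p$, and $u(x)$ is the unique minimizer of $\mathcal{L}(\cdot,x)$ over $U$.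 The function $d$ is concave and differentiable with $\nabla d(x) = -Gu(x)-g$, Lipschitz with constant $L_{\mathrm d} = \|G\|^2/\sigma_{\mathrm f}$ ($\|G\|$ the spectral norm). Standing assumption: there exists a finite optimal Lagrange multiplier for the conic constraint, so that $f^* = \max_{x\in\mathcal{K}^*} d(x)$ and the set $X^*\subseteq\mathcal{K}^*$ of maximizers is nonempty. $[z]_C$ denotes Euclidean projection onto $C$ and $\mathrm{dist}_C(z)=\min_{w\in C}\|w-z\|$. Algorithm (DG): given $x^0\in\mathcal{K}^*$, for $k\ge 0$ compute $u^k = u(x^k)=\arg\min_{u\in U}\mathcal{L}(u,x^k)$ and $x^{k+1} = [x^k + \alpha_k\nabla d(x^k)]_{\mathcal{K}^*}$, where the step sizes satisfy $\frac{1}{L_G}\le\alpha_k\le\frac{1}{L_{\mathrm d}}$ for a constant $L_G\ge L_{\mathrm d}$. $\tilde u\in U$ is an $\epsilon$-primal solution if $\mathrm{dist}_{\mathcal{K}}(G\tilde u+g)\le\mathcal{O}(\epsilon)$ and $-\mathcal{O}(\epsilon)\le f(\tilde u)-f^*\le\mathcal{O}(\epsilon)$; constants in $\mathcal{O}$ may depend on the problem data, $x^0$ and $L_G$, but not on $\epsilon$ or $k$. *)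

theory Defs
  imports "HOL-Analysis.Analysis"
begin

definition strongly_convex :: "real \<Rightarrow> ('a::real_normed_vector \<Rightarrow> real) \<Rightarrow> bool" where
  "strongly_convex \<sigma> f \<longleftrightarrow>
     (\<forall>x y. \<forall>t\<in>{0..1}. f (t *\<^sub>R x + (1 - t) *\<^sub>R y)
        \<le> t * f x + (1 - t) * f y - \<sigma> / 2 * t * (1 - t) * (norm (x - y))\<^sup>2)"

definition proper_cone :: "'a::real_normed_vector set \<Rightarrow> bool" where
  "proper_cone K \<longleftrightarrow> cone K \<and> closed K \<and> convex K
     \<and> (\<forall>z. z \<in> K \<and> - z \<in> K \<longrightarrow> z = 0) \<and> interior K \<noteq> {}"

definition dual_cone :: "'a::real_inner set \<Rightarrow> 'a set" where
  "dual_cone K = {x. \<forall>z\<in>K. 0 \<le> x \<bullet> z}"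

definition feasible_set ::
    "real ^ 'n ^ 'p \<Rightarrow> real ^ 'p \<Rightarrow> (real ^ 'p) set \<Rightarrow> (real ^ 'n) set \<Rightarrow> (real ^ 'n) set" where
  "feasible_set G g K U = {u \<in> U. G *v u + g \<in> K}"

(* Both minima below are written as infima. For f strongly convex and U closed, convex and
   nonempty they are attained (for opt_val provided the feasible set is nonempty). *)

definition opt_val :: "(real ^ 'n \<Rightarrow> real) \<Rightarrow> real ^ 'n ^ 'p \<Rightarrow> real ^ 'p
    \<Rightarrow> (real ^ 'p) set \<Rightarrow> (real ^ 'n) set \<Rightarrow> real" where
  "opt_val f G g K U = (INF u\<in>feasible_set G g K U. f u)"

definition lagrangian :: "(real ^ 'n \<Rightarrow> real) \<Rightarrow> real ^ 'n ^ 'p \<Rightarrow> real ^ 'p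
    \<Rightarrow> real ^ 'n \<Rightarrow> real ^ 'p \<Rightarrow> real" where
  "lagrangian f G g u x = f u - x \<bullet> (G *v u + g)"

definition dual_fun :: "(real ^ 'n \<Rightarrow> real) \<Rightarrow> real ^ 'n ^ 'p \<Rightarrow> real ^ 'p
    \<Rightarrow> (real ^ 'n) set \<Rightarrow> real ^ 'p \<Rightarrow> real" where
  "dual_fun f G g U x = (INF u\<in>U. lagrangian f G g u x)"

definition gradient :: "('a::real_inner \<Rightarrow> real) \<Rightarrow> 'a \<Rightarrow> 'a" where
  "gradient h x = (THE D. GDERIV h x :> D)"

definition lipschitz_dual :: "real \<Rightarrow> real ^ 'n ^ 'p \<Rightarrow> real" where
  "lipschitz_dual \<sigma> G = (onorm ((*v) G))\<^sup>2 / \<sigma>"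

definition DG_iterates :: "(real ^ 'n \<Rightarrow> real) \<Rightarrow> real ^ 'n ^ 'p \<Rightarrow> real ^ 'p
    \<Rightarrow> (real ^ 'p) set \<Rightarrow> (real ^ 'n) set \<Rightarrow> real ^ 'p
    \<Rightarrow> (nat \<Rightarrow> real) \<Rightarrow> (nat \<Rightarrow> real ^ 'p) \<Rightarrow> (nat \<Rightarrow> real ^ 'n) \<Rightarrow> bool" where
  "DG_iterates f G g K U x0 \<alpha> x u \<longleftrightarrow>
     x 0 = x0 \<and>
     (\<forall>k. is_arg_min (\<lambda>v. lagrangian f G g v (x k)) (\<lambda>v. v \<in> U) (u k)
        \<and> x (Suc k) = closest_point (dual_cone K)
             (x k + \<alpha> k *\<^sub>R gradient (dual_fun f G g U) (x k)))"

definition avg_iterate :: "(nat \<Rightarrow> real) \<Rightarrow> (nat \<Rightarrow> 'a::real_vector) \<Rightarrow> nat \<Rightarrow> 'a" where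
  "avg_iterate \<alpha> u k = (1 / (\<Sum>j\<le>k. \<alpha> j)) *\<^sub>R (\<Sum>j\<le>k. \<alpha> j *\<^sub>R u j)"

(* The argument e is the accuracy including the constant hidden in the O-notation. *)
definition primal_solution :: "(real ^ 'n \<Rightarrow> real) \<Rightarrow> real ^ 'n ^ 'p \<Rightarrow> real ^ 'p
    \<Rightarrow> (real ^ 'p) set \<Rightarrow> (real ^ 'n) set \<Rightarrow> real \<Rightarrow> real ^ 'n \<Rightarrow> bool" where
  "primal_solution f G g K U e u \<longleftrightarrow>
     u \<in> U \<and> infdist (G *v u + g) K \<le> e
     \<and> - e \<le> f u - opt_val f G g K U \<and> f u - opt_val f G g K U \<le> e"

end

theory Submission
  imports Defs
begin

text \<open>
  Everything rests on one inequality for a single step of the method, valid for every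
  \<open>y\<close> in the dual cone:
  \<open>\<parallel>x\<^bsup>k+1\<^esup> - y\<parallel>\<^sup>2 + 2 \<alpha>\<^sub>k \<L>(u\<^sup>k, y) \<le> \<parallel>x\<^sup>k - y\<parallel>\<^sup>2 + 2 \<alpha>\<^sub>k d(x\<^bsup>k+1\<^esup>)\<close>.
  It combines the variational inequality of the projection with the fact that the dual function
  lies between the affine function \<open>\<L>(u\<^sup>k, \<cdot>)\<close> and the same function minus
  \<open>L\<^sub>d/2 \<parallel>\<cdot> - x\<^sup>k\<parallel>\<^sup>2\<close>; the lower bound is quadratic growth of the strongly
  convex Lagrangian around its minimizer (\<open>dual_fun_lower_quadratic\<close>), and the two bounds
  also identify the gradient of the dual function. A step size at most \<open>1/L\<^sub>d\<close> absorbs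
  the quadratic error.

  Since \<open>d \<le> f\<^sup>*\<close> on the dual cone, the inequality telescopes with no error left over, and
  two choices of \<open>y\<close> give what is needed. For a multiplier \<open>y = x\<^sup>*\<close>, where
  \<open>\<L>(u\<^sup>k, x\<^sup>*) \<ge> f\<^sup>*\<close>, the dual iterates stay within distance
  \<open>\<parallel>x\<^sup>0 - x\<^sup>*\<parallel>\<close> of \<open>x\<^sup>*\<close>. For \<open>y = 0\<close>, where the Lagrangian is \<open>f\<close>
  itself, convexity of \<open>f\<close> bounds the suboptimality of the average by
  \<open>\<parallel>x\<^sup>0\<parallel>\<^sup>2 / (2 S\<^sub>k)\<close>.

  Feasibility comes from Moreau's decomposition: the correction made by projecting onto the dual
  cone lies in \<open>K\<close>, so \<open>x\<^bsup>k+1\<^esup> - x\<^sup>k + \<alpha>\<^sub>k (G u\<^sup>k + g) \<in> K\<close>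
  (\<open>closest_point_dual_cone_residual\<close>). Summing, the
  constraint value of the average misses \<open>K\<close> by at most
  \<open>\<parallel>x\<^bsup>k+1\<^esup> - x\<^sup>0\<parallel> / S\<^sub>k\<close>, and pairing the same relation with \<open>x\<^sup>*\<close>
  bounds the objective from below. As \<open>S\<^sub>k \<ge> (k+1)/L\<^sub>G\<close>, all three errors are
  of order \<open>1/k\<close>.
\<close>

section \<open>Dual cones and Moreau's decomposition\<close>

lemma dual_cone_eq_Inter: "dual_cone K = (\<Inter>z\<in>K. {x. z \<bullet> x \<ge> 0})"
  by (auto simp: dual_cone_def inner_commute)

lemma closed_dual_cone: "closed (dual_cone K)"
  unfolding dual_cone_eq_Inter by (intro closed_INT ballI closed_halfspace_ge)

lemma convex_dual_cone: "convex (dual_cone K)"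
  unfolding dual_cone_eq_Inter by (intro convex_INT convex_halfspace_ge)

lemma zero_in_dual_cone: "0 \<in> dual_cone K"
  by (simp add: dual_cone_def)

lemma dual_cone_nonempty: "dual_cone K \<noteq> {}"
  using zero_in_dual_cone by blast

lemma add_in_dual_cone: "x \<in> dual_cone K \<Longrightarrow> y \<in> dual_cone K \<Longrightarrow> x + y \<in> dual_cone K"
  by (simp add: dual_cone_def inner_add_left)

text \<open>A point outside the cone is cut off by a hyperplane, and the cone property forces the normal
  of that hyperplane into the dual cone.\<close>

lemma dual_cone_dual_cone:
  fixes K :: "'a::euclidean_space set"
  assumes "cone K" "closed K" "convex K" "K \<noteq> {}"
  shows "dual_cone (dual_cone K) = K"
proof
  show "K \<subseteq> dual_cone (dual_cone K)"
    by (auto simp: dual_cone_def inner_commute)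
  show "dual_cone (dual_cone K) \<subseteq> K"
  proof
    fix w assume w: "w \<in> dual_cone (dual_cone K)"
    show "w \<in> K"
    proof (rule ccontr)
      assume "w \<notin> K"
      then obtain a b where ab: "a \<bullet> w < b" "\<forall>y\<in>K. a \<bullet> y > b"
        using separating_hyperplane_closed_point[OF assms(3,2)] by blast
      have "0 \<in> K"
        using assms(1,4) by (simp add: cone_contains_0)
      hence b: "b < 0"
        using ab(2) by force
      have "a \<bullet> y \<ge> 0" if y: "y \<in> K" for y
      proof (rule ccontr)
        assume neg: "\<not> a \<bullet> y \<ge> 0"
        \<comment> \<open>This multiple of \<open>y\<close> lands exactly on the separating hyperplane.\<close>
        have "(b / (a \<bullet> y)) *\<^sub>R y \<in> K"
          using assms(1) y b neg by (simp add: cone_def divide_nonpos_nonpos)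
        hence "a \<bullet> ((b / (a \<bullet> y)) *\<^sub>R y) > b"
          using ab(2) by blast
        thus False
          using neg by simp
      qed
      hence "a \<in> dual_cone K"
        by (simp add: dual_cone_def)
      hence "w \<bullet> a \<ge> 0"
        using w by (simp add: dual_cone_def)
      thus False
        using ab(1) b by (simp add: inner_commute)
    qed
  qed
qed

text \<open>Testing the variational inequality of the projection \<open>p\<close> at \<open>p + y\<close> for \<open>y\<close> in the
  dual cone shows that the residual pairs nonnegatively with the whole dual cone.\<close>

lemma closest_point_dual_cone_residual:
  fixes K :: "'a::euclidean_space set"
  assumes "cone K" "closed K" "convex K" "K \<noteq> {}"
  shows "closest_point (dual_cone K) z - z \<in> K"
proof -
  let ?p = "closest_point (dual_cone K) z"
  have p: "?p \<in> dual_cone K"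
    by (rule closest_point_in_set[OF closed_dual_cone dual_cone_nonempty])
  have "(?p - z) \<bullet> y \<ge> 0" if "y \<in> dual_cone K" for y
    using closest_point_dot[OF convex_dual_cone closed_dual_cone add_in_dual_cone[OF p that], of z]
    by (simp add: inner_diff_left)
  hence "?p - z \<in> dual_cone (dual_cone K)"
    by (simp add: dual_cone_def)
  thus ?thesis
    using dual_cone_dual_cone[OF assms] by simp
qed

section \<open>A projected gradient step\<close>

text \<open>The hypothesis \<open>lower\<close> is the descent lemma for a concave function with
  \<open>L\<close>-Lipschitz gradient \<open>D\<close>. The point \<open>y\<close> is compared through the linearization
  \<open>h x + D \<bullet> (y - x)\<close> and not through \<open>h y\<close>, so that comparison points other than
  maximizers give information as well.\<close>

lemma projected_gradient_step:
  fixes x x' D y :: "'a::euclidean_space"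
  assumes C: "convex C" "closed C" and y: "y \<in> C"
    and x': "x' = closest_point C (x + a *\<^sub>R D)"
    and a: "0 \<le> a" "a * L \<le> 1"
    and lower: "h x + D \<bullet> (x' - x) - L / 2 * (norm (x' - x))\<^sup>2 \<le> h x'"
  shows "(norm (x' - y))\<^sup>2 + 2 * a * (h x + D \<bullet> (y - x)) \<le> (norm (x - y))\<^sup>2 + 2 * a * h x'"
proof -
  have var: "(x + a *\<^sub>R D - x') \<bullet> (y - x') \<le> 0"
    unfolding x' by (rule closest_point_dot[OF C y])
  have identity: "(norm (x' - y))\<^sup>2 + 2 * (a * (D \<bullet> (y - x)))
      = (norm (x - y))\<^sup>2 + 2 * ((x + a *\<^sub>R D - x') \<bullet> (y - x'))
        + 2 * (a * (D \<bullet> (x' - x))) - (norm (x' - x))\<^sup>2"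
    by (simp add: power2_norm_eq_inner inner_diff_left inner_diff_right inner_add_left
        inner_commute algebra_simps)
  have "a * (h x + D \<bullet> (x' - x) - L / 2 * (norm (x' - x))\<^sup>2) \<le> a * h x'"
    by (rule mult_left_mono[OF lower a(1)])
  moreover have "a * L * (norm (x' - x))\<^sup>2 \<le> 1 * (norm (x' - x))\<^sup>2"
    by (rule mult_right_mono[OF a(2)]) simp
  ultimately show ?thesis
    using var identity by (simp add: algebra_simps)
qed

section \<open>The dual function\<close>

text \<open>Strong convexity along the segment from the minimizer to \<open>v\<close>, compared with minimality,
  gives the growth with an extra factor \<open>1 - t\<close>, which disappears as \<open>t\<close> tends to zero.\<close>

lemma lagrangian_quadratic_growth:
  fixes G :: "real ^ 'n ^ 'p"
  assumes sc: "strongly_convex \<sigma> f" and U: "convex U"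
    and min: "is_arg_min (\<lambda>v. lagrangian f G g v x) (\<lambda>v. v \<in> U) u" and v: "v \<in> U"
  shows "lagrangian f G g u x + \<sigma> / 2 * (norm (v - u))\<^sup>2 \<le> lagrangian f G g v x"
proof -
  let ?A = "\<sigma> / 2 * (norm (v - u))\<^sup>2"
  have u: "u \<in> U"
    using min by (simp add: is_arg_min_def)
  have "z * ?A \<le> lagrangian f G g v x - lagrangian f G g u x" if z: "0 < z" "z < 1" for z
  proof -
    define t where "t = 1 - z"
    have t: "0 < t" "t < 1" "z = 1 - t"
      using z by (auto simp: t_def)
    let ?w = "t *\<^sub>R v + (1 - t) *\<^sub>R u"
    have "?w \<in> U"
      using convexD[OF U v u, of t "1 - t"] t by simp
    hence "lagrangian f G g u x \<le> lagrangian f G g ?w x"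
      using min by (force simp: is_arg_min_def not_less)
    also have "\<dots> = f ?w - t * (x \<bullet> (G *v v + g)) - (1 - t) * (x \<bullet> (G *v u + g))"
      by (simp add: lagrangian_def matrix_vector_mult_add_rdistrib matrix_vector_right_distrib
          matrix_vector_mult_scaleR inner_add_right algebra_simps)
    also have "\<dots> \<le> (t * f v + (1 - t) * f u - \<sigma> / 2 * t * (1 - t) * (norm (v - u))\<^sup>2)
        - t * (x \<bullet> (G *v v + g)) - (1 - t) * (x \<bullet> (G *v u + g))"
    proof -
      have "t \<in> {0..1}"
        using t by simp
      thus ?thesis
        using sc unfolding strongly_convex_def by (intro diff_right_mono) blast
    qed
    finally have "t * (z * ?A) \<le> t * (lagrangian f G g v x - lagrangian f G g u x)"
      by (simp add: lagrangian_def t(3) algebra_simps)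
    thus ?thesis
      using t by simp
  qed
  hence "?A \<le> lagrangian f G g v x - lagrangian f G g u x"
    by (rule field_le_mult_one_interval)
  thus ?thesis
    by simp
qed

lemma lagrangian_affine:
  "lagrangian f G g u y = lagrangian f G g u x + (- (G *v u + g)) \<bullet> (y - x)"
  by (simp add: lagrangian_def inner_diff_right inner_commute algebra_simps)

lemma lipschitz_dual_pos:
  fixes G :: "real ^ 'n ^ 'p"
  assumes "\<sigma> > 0" "G \<noteq> 0"
  shows "lipschitz_dual \<sigma> G > 0"
proof -
  have "\<not> (\<forall>v. G *v v = 0)"
    using assms(2) by (simp add: matrix_eq)
  hence "onorm ((*v) G) > 0"
    by (simp add: onorm_pos_lt matrix_vector_mul_bounded_linear)
  thus ?thesis
    using assms(1) by (simp add: lipschitz_dual_def)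
qed

text \<open>Moving the multiplier from \<open>x\<close> to \<open>y\<close> changes the Lagrangian at \<open>v\<close> by a bilinear
  term. Completing the square, the growth in \<open>v - u\<close> compensates the part of that term which
  depends on \<open>v\<close>, up to \<open>\<parallel>G\<parallel>\<^sup>2/(2\<sigma>) \<parallel>y - x\<parallel>\<^sup>2\<close>.\<close>

lemma lagrangian_lower_quadratic:
  fixes G :: "real ^ 'n ^ 'p"
  assumes \<sigma>: "\<sigma> > 0" and sc: "strongly_convex \<sigma> f" and U: "convex U"
    and min: "is_arg_min (\<lambda>v. lagrangian f G g v x) (\<lambda>v. v \<in> U) u" and v: "v \<in> U"
  shows "lagrangian f G g u y - lipschitz_dual \<sigma> G / 2 * (norm (y - x))\<^sup>2 \<le> lagrangian f G g v y"
proof -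
  let ?N = "onorm ((*v) G)"
  let ?a = "norm (v - u)" and ?b = "?N * norm (y - x)"
  have "(G *v (v - u)) \<bullet> (y - x) \<le> norm (G *v (v - u)) * norm (y - x)"
    by (rule norm_cauchy_schwarz)
  also have "\<dots> \<le> (?N * ?a) * norm (y - x)"
    by (intro mult_right_mono onorm matrix_vector_mul_bounded_linear norm_ge_zero)
  also have "\<dots> = ?a * ?b"
    by simp
  also have "\<dots> \<le> \<sigma> / 2 * ?a\<^sup>2 + ?b\<^sup>2 / (2 * \<sigma>)"
  proof -
    have "0 \<le> (\<sigma> * ?a - ?b)\<^sup>2 / (2 * \<sigma>)"
      using \<sigma> by simp
    also have "\<dots> = \<sigma> / 2 * ?a\<^sup>2 + ?b\<^sup>2 / (2 * \<sigma>) - ?a * ?b"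
      using \<sigma> by (simp add: power2_eq_square field_simps)
    finally show ?thesis
      by simp
  qed
  also have "?b\<^sup>2 / (2 * \<sigma>) = lipschitz_dual \<sigma> G / 2 * (norm (y - x))\<^sup>2"
    by (simp add: lipschitz_dual_def power_mult_distrib)
  finally have bilinear: "(G *v (v - u)) \<bullet> (y - x)
      \<le> \<sigma> / 2 * ?a\<^sup>2 + lipschitz_dual \<sigma> G / 2 * (norm (y - x))\<^sup>2" .
  have "lagrangian f G g v y = lagrangian f G g v x + (- (G *v v + g)) \<bullet> (y - x)"
    by (rule lagrangian_affine)
  moreover have "(- (G *v v + g)) \<bullet> (y - x)
      = (- (G *v u + g)) \<bullet> (y - x) - (G *v (v - u)) \<bullet> (y - x)"
    by (simp add: matrix_vector_mult_diff_distrib inner_diff_left inner_add_left)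
  moreover note lagrangian_affine[of f G g u y x] bilinear
    lagrangian_quadratic_growth[OF sc U min v]
  ultimately show ?thesis
    by linarith
qed

text \<open>That the Lagrangian has a minimizer at a single multiplier already makes it bounded below at
  every multiplier, so the infimum defining the dual function is a genuine one everywhere.\<close>

lemma lagrangian_bdd_below:
  fixes G :: "real ^ 'n ^ 'p"
  assumes "\<sigma> > 0" "strongly_convex \<sigma> f" "convex U"
    and "is_arg_min (\<lambda>v. lagrangian f G g v x) (\<lambda>v. v \<in> U) u"
  shows "bdd_below ((\<lambda>v. lagrangian f G g v y) ` U)"
  using lagrangian_lower_quadratic[OF assms] by (rule bdd_belowI2)

lemma dual_fun_le_lagrangian:
  fixes G :: "real ^ 'n ^ 'p"
  assumes "\<sigma> > 0" "strongly_convex \<sigma> f" "convex U"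
    and "is_arg_min (\<lambda>v. lagrangian f G g v x) (\<lambda>v. v \<in> U) u" and "v \<in> U"
  shows "dual_fun f G g U y \<le> lagrangian f G g v y"
  unfolding dual_fun_def by (rule cINF_lower[OF lagrangian_bdd_below[OF assms(1-4)] assms(5)])

lemma dual_fun_lower_quadratic:
  fixes G :: "real ^ 'n ^ 'p"
  assumes "\<sigma> > 0" "strongly_convex \<sigma> f" "convex U"
    and min: "is_arg_min (\<lambda>v. lagrangian f G g v x) (\<lambda>v. v \<in> U) u"
  shows "lagrangian f G g u y - lipschitz_dual \<sigma> G / 2 * (norm (y - x))\<^sup>2 \<le> dual_fun f G g U y"
proof -
  have "U \<noteq> {}"
    using min by (auto simp: is_arg_min_def)
  thus ?thesis
    unfolding dual_fun_def by (rule cINF_greatest[OF _ lagrangian_lower_quadratic[OF assms]])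
qed

lemma dual_fun_at_minimizer:
  fixes G :: "real ^ 'n ^ 'p"
  assumes "\<sigma> > 0" "strongly_convex \<sigma> f" "convex U"
    and min: "is_arg_min (\<lambda>v. lagrangian f G g v x) (\<lambda>v. v \<in> U) u"
  shows "dual_fun f G g U x = lagrangian f G g u x"
proof (rule antisym)
  show "dual_fun f G g U x \<le> lagrangian f G g u x"
    using dual_fun_le_lagrangian[OF assms] min by (simp add: is_arg_min_def)
  show "lagrangian f G g u x \<le> dual_fun f G g U x"
    using dual_fun_lower_quadratic[OF assms, of x] by simp
qed

lemma GDERIV_of_quadratic_error:
  fixes h :: "'a::real_inner \<Rightarrow> real"
  assumes "\<And>y. \<bar>h y - h x - D \<bullet> (y - x)\<bar> \<le> c * (norm (y - x))\<^sup>2"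
  shows "GDERIV h x :> D"
  unfolding gderiv_def has_derivative_at2
proof
  show "bounded_linear (\<lambda>v. v \<bullet> D)"
    by (rule bounded_linear_inner_left)
  let ?q = "\<lambda>y. (1 / norm (y - x)) *\<^sub>R (h y - (h x + (y - x) \<bullet> D))"
  have "norm (?q y) \<le> c * norm (y - x)" for y
  proof (cases "y = x")
    case False
    have "norm (?q y) = \<bar>h y - h x - D \<bullet> (y - x)\<bar> / norm (y - x)"
      by (simp add: abs_mult inner_commute diff_diff_eq)
    also have "\<dots> \<le> c * (norm (y - x))\<^sup>2 / norm (y - x)"
      by (rule divide_right_mono[OF assms]) simp
    also have "\<dots> = c * norm (y - x)"
      using False by (simp add: power2_eq_square)
    finally show ?thesis .
  qed simp
  moreover have "((\<lambda>y. c * norm (y - x)) \<longlongrightarrow> 0) (at x)"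
    by (rule tendsto_eq_intros refl | simp)+
  ultimately show "(?q \<longlongrightarrow> 0) (at x)"
    using Lim_null_comparison[of ?q "\<lambda>y. c * norm (y - x)" "at x"] by (simp add: always_eventually)
qed

lemma gradient_eqI:
  assumes "GDERIV h x :> D"
  shows "gradient h x = D"
  unfolding gradient_def
proof (rule the_equality[of "\<lambda>D. GDERIV h x :> D", OF assms])
  fix D' assume "GDERIV h x :> D'"
  hence "(\<lambda>v. v \<bullet> D') = (\<lambda>v. v \<bullet> D)"
    using assms unfolding gderiv_def by (rule has_derivative_unique)
  hence "\<forall>v. v \<bullet> D' = v \<bullet> D"
    by (simp add: fun_eq_iff)
  thus "D' = D"
    by (simp only: vector_eq_ldot)
qed

lemma gradient_dual_fun:
  fixes G :: "real ^ 'n ^ 'p"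
  assumes "\<sigma> > 0" "strongly_convex \<sigma> f" "convex U"
    and min: "is_arg_min (\<lambda>v. lagrangian f G g v x) (\<lambda>v. v \<in> U) u"
  shows "gradient (dual_fun f G g U) x = - (G *v u + g)"
proof (rule gradient_eqI, rule GDERIV_of_quadratic_error)
  fix y
  have "u \<in> U"
    using min by (simp add: is_arg_min_def)
  moreover have "0 \<le> lipschitz_dual \<sigma> G / 2 * (norm (y - x))\<^sup>2"
    using assms(1) by (simp add: lipschitz_dual_def)
  ultimately show "\<bar>dual_fun f G g U y - dual_fun f G g U x - (- (G *v u + g)) \<bullet> (y - x)\<bar>
      \<le> lipschitz_dual \<sigma> G / 2 * (norm (y - x))\<^sup>2"
    using dual_fun_le_lagrangian[OF assms, of u y] dual_fun_lower_quadratic[OF assms, of y]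
      dual_fun_at_minimizer[OF assms] lagrangian_affine[of f G g u y x]
    unfolding abs_le_iff by linarith
qed

section \<open>Telescoping along the iterates\<close>

lemma DG_iterates_Suc:
  fixes G :: "real ^ 'n ^ 'p"
  assumes "\<sigma> > 0" "strongly_convex \<sigma> f" "convex U" and DG: "DG_iterates f G g K U x0 \<alpha> x u"
  shows "x (Suc k) = closest_point (dual_cone K) (x k + \<alpha> k *\<^sub>R (- (G *v u k + g)))"
proof -
  have min: "is_arg_min (\<lambda>v. lagrangian f G g v (x k)) (\<lambda>v. v \<in> U) (u k)"
    using DG by (simp add: DG_iterates_def)
  show ?thesis
    using DG unfolding DG_iterates_def gradient_dual_fun[OF assms(1-3) min, symmetric] by blast
qed

lemma DG_iterates_in_dual_cone:
  assumes "x0 \<in> dual_cone K" "DG_iterates f G g K U x0 \<alpha> x u"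
  shows "x k \<in> dual_cone K"
proof (cases k)
  case 0
  thus ?thesis
    using assms by (simp add: DG_iterates_def)
next
  case (Suc j)
  thus ?thesis
    using assms(2) closest_point_in_set[OF closed_dual_cone dual_cone_nonempty]
    by (simp add: DG_iterates_def)
qed

text \<open>The linearization of the dual function at \<open>x\<^sup>k\<close> is \<open>\<L>(u\<^sup>k, \<cdot>)\<close>, which
  turns the general projected gradient estimate into a statement about the Lagrangian.\<close>

lemma DG_step:
  fixes G :: "real ^ 'n ^ 'p"
  assumes pr: "\<sigma> > 0" "strongly_convex \<sigma> f" "convex U"
    and DG: "DG_iterates f G g K U x0 \<alpha> x u"
    and a: "0 \<le> \<alpha> k" "\<alpha> k * lipschitz_dual \<sigma> G \<le> 1" and y: "y \<in> dual_cone K"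
  shows "(norm (x (Suc k) - y))\<^sup>2 + 2 * \<alpha> k * lagrangian f G g (u k) y
    \<le> (norm (x k - y))\<^sup>2 + 2 * \<alpha> k * dual_fun f G g U (x (Suc k))"
proof -
  have min: "is_arg_min (\<lambda>v. lagrangian f G g v (x k)) (\<lambda>v. v \<in> U) (u k)"
    using DG by (simp add: DG_iterates_def)
  have lin: "lagrangian f G g (u k) z
      = dual_fun f G g U (x k) + (- (G *v u k + g)) \<bullet> (z - x k)" for z
    using lagrangian_affine[of f G g "u k" z "x k"] dual_fun_at_minimizer[OF pr min] by simp
  show ?thesis
    unfolding lin
    by (rule projected_gradient_step[OF convex_dual_cone closed_dual_cone y
          DG_iterates_Suc[OF pr DG] a])
      (use dual_fun_lower_quadratic[OF pr min, of "x (Suc k)"] lin in simp)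
qed

text \<open>Bounding the dual value at the new iterate by a constant \<open>M\<close> leaves only the squared
  distances to \<open>y\<close>, which telescope.\<close>

lemma DG_sum_lagrangian:
  fixes G :: "real ^ 'n ^ 'p"
  assumes pr: "\<sigma> > 0" "strongly_convex \<sigma> f" "convex U"
    and x0: "x0 \<in> dual_cone K" and DG: "DG_iterates f G g K U x0 \<alpha> x u"
    and a: "\<And>k. 0 \<le> \<alpha> k" "\<And>k. \<alpha> k * lipschitz_dual \<sigma> G \<le> 1"
    and y: "y \<in> dual_cone K" and M: "\<And>z. z \<in> dual_cone K \<Longrightarrow> dual_fun f G g U z \<le> M"
  shows "(norm (x (Suc k) - y))\<^sup>2 + 2 * (\<Sum>j\<le>k. \<alpha> j * lagrangian f G g (u j) y)
    \<le> (norm (x0 - y))\<^sup>2 + 2 * (\<Sum>j\<le>k. \<alpha> j) * M"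
proof -
  have step: "(norm (x (Suc j) - y))\<^sup>2 + 2 * (\<alpha> j * lagrangian f G g (u j) y)
      \<le> (norm (x j - y))\<^sup>2 + 2 * (\<alpha> j * M)" for j
  proof -
    have "\<alpha> j * dual_fun f G g U (x (Suc j)) \<le> \<alpha> j * M"
      by (intro mult_left_mono M DG_iterates_in_dual_cone[OF x0 DG] a(1))
    thus ?thesis
      using DG_step[OF pr DG a(1,2) y, of j] by simp
  qed
  show ?thesis
  proof (induction k)
    case 0
    have "x 0 = x0"
      using DG by (simp add: DG_iterates_def)
    thus ?case
      using step[of 0] by simp
  next
    case (Suc k)
    thus ?case
      using step[of "Suc k"] by (simp add: algebra_simps)
  qed
qed

lemma DG_iterates_bounded:
  fixes G :: "real ^ 'n ^ 'p"
  assumes pr: "\<sigma> > 0" "strongly_convex \<sigma> f" "convex U"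
    and x0: "x0 \<in> dual_cone K" and DG: "DG_iterates f G g K U x0 \<alpha> x u"
    and a: "\<And>k. 0 \<le> \<alpha> k" "\<And>k. \<alpha> k * lipschitz_dual \<sigma> G \<le> 1"
    and xs: "is_arg_max (dual_fun f G g U) (\<lambda>x. x \<in> dual_cone K) xs"
  shows "norm (x (Suc k) - xs) \<le> norm (x0 - xs)"
proof -
  have xsK: "xs \<in> dual_cone K" and max: "\<And>z. z \<in> dual_cone K \<Longrightarrow>
      dual_fun f G g U z \<le> dual_fun f G g U xs"
    using xs by (auto simp: is_arg_max_def not_less)
  have "(\<Sum>j\<le>k. \<alpha> j) * dual_fun f G g U xs \<le> (\<Sum>j\<le>k. \<alpha> j * lagrangian f G g (u j) xs)"
    unfolding sum_distrib_right
  proof (intro sum_mono mult_left_mono a(1))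
    fix j
    have min: "is_arg_min (\<lambda>v. lagrangian f G g v (x j)) (\<lambda>v. v \<in> U) (u j)"
      using DG by (simp add: DG_iterates_def)
    thus "dual_fun f G g U xs \<le> lagrangian f G g (u j) xs"
      using dual_fun_le_lagrangian[OF pr min] by (simp add: is_arg_min_def)
  qed
  hence "(norm (x (Suc k) - xs))\<^sup>2 \<le> (norm (x0 - xs))\<^sup>2"
    using DG_sum_lagrangian[OF pr x0 DG a xsK max, where k = k] unfolding mult.assoc by linarith
  thus ?thesis
    by (rule power2_le_imp_le) simp
qed

text \<open>The projection residuals of all steps lie in the cone \<open>K\<close>, hence so does their sum, in which
  the iterates telescope.\<close>

lemma DG_constraint_sum_in_cone:
  fixes G :: "real ^ 'n ^ 'p"
  assumes pr: "\<sigma> > 0" "strongly_convex \<sigma> f" "convex U"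
    and K: "cone K" "closed K" "convex K" "K \<noteq> {}"
    and DG: "DG_iterates f G g K U x0 \<alpha> x u"
  shows "x (Suc k) - x0 + (\<Sum>j\<le>k. \<alpha> j *\<^sub>R (G *v u j + g)) \<in> K"
proof -
  have step: "x (Suc j) - x j + \<alpha> j *\<^sub>R (G *v u j + g) \<in> K" for j
    using closest_point_dual_cone_residual[OF K, of "x j + \<alpha> j *\<^sub>R (- (G *v u j + g))"]
    unfolding DG_iterates_Suc[OF pr DG, symmetric] by (simp add: algebra_simps)
  show ?thesis
  proof (induction k)
    case 0
    have "x 0 = x0"
      using DG by (simp add: DG_iterates_def)
    thus ?case
      using step[of 0] by simp
  next
    case (Suc k)
    have "(x (Suc k) - x0 + (\<Sum>j\<le>k. \<alpha> j *\<^sub>R (G *v u j + g)))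
        + (x (Suc (Suc k)) - x (Suc k) + \<alpha> (Suc k) *\<^sub>R (G *v u (Suc k) + g)) \<in> K"
      using K(1,3) convex_cone[of K] Suc.IH step[of "Suc k"] by blast
    thus ?case
      by (simp add: algebra_simps)
  qed
qed

section \<open>The averaged primal iterate\<close>

lemma avg_iterate_eq_sum:
  "avg_iterate \<alpha> u k = (\<Sum>j\<le>k. (\<alpha> j / (\<Sum>j\<le>k. \<alpha> j)) *\<^sub>R u j)"
  unfolding avg_iterate_def scaleR_sum_right by simp

lemma avg_iterate_in_convex:
  assumes "convex U" "\<And>j. u j \<in> U" "\<And>j. 0 \<le> \<alpha> j" "(\<Sum>j\<le>k. \<alpha> j) > 0"
  shows "avg_iterate \<alpha> u k \<in> U"
  unfolding avg_iterate_eq_sum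
  by (rule convex_sum) (use assms in \<open>auto simp flip: sum_divide_distrib\<close>)

lemma strongly_convex_imp_convex_on:
  assumes "\<sigma> \<ge> 0" "strongly_convex \<sigma> f"
  shows "convex_on UNIV f"
proof (rule convex_onI)
  fix t :: real and x y :: 'a
  assume t: "0 < t" "t < 1"
  have "f ((1 - t) *\<^sub>R x + t *\<^sub>R y)
      \<le> t * f y + (1 - t) * f x - \<sigma> / 2 * t * (1 - t) * (norm (y - x))\<^sup>2"
    using assms(2) t unfolding strongly_convex_def by (simp add: add.commute)
  also have "\<dots> \<le> (1 - t) * f x + t * f y"
    using assms(1) t by simp
  finally show "f ((1 - t) *\<^sub>R x + t *\<^sub>R y) \<le> (1 - t) * f x + t * f y" .
qed simp

lemma avg_iterate_convex_on_le:
  assumes "convex_on UNIV f" "\<And>j. 0 \<le> \<alpha> j" "(\<Sum>j\<le>k. \<alpha> j) > 0"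
  shows "(\<Sum>j\<le>k. \<alpha> j) * f (avg_iterate \<alpha> u k) \<le> (\<Sum>j\<le>k. \<alpha> j * f (u j))"
proof -
  let ?S = "\<Sum>j\<le>k. \<alpha> j"
  have "f (avg_iterate \<alpha> u k) \<le> (\<Sum>j\<le>k. \<alpha> j / ?S * f (u j))"
    unfolding avg_iterate_eq_sum
    by (rule convex_on_sum[OF _ _ assms(1)])
      (use assms in \<open>auto simp flip: sum_divide_distrib\<close>)
  also have "\<dots> = (\<Sum>j\<le>k. \<alpha> j * f (u j)) / ?S"
    by (simp add: sum_divide_distrib)
  finally show ?thesis
    using assms(3) by (simp add: field_simps)
qed

lemma avg_iterate_affine:
  fixes G :: "real ^ 'n ^ 'p"
  assumes "(\<Sum>j\<le>k. \<alpha> j) \<noteq> 0"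
  shows "(\<Sum>j\<le>k. \<alpha> j) *\<^sub>R (G *v avg_iterate \<alpha> u k + g) = (\<Sum>j\<le>k. \<alpha> j *\<^sub>R (G *v u j + g))"
proof -
  have "(\<Sum>j\<le>k. \<alpha> j) *\<^sub>R (G *v avg_iterate \<alpha> u k) = G *v (\<Sum>j\<le>k. \<alpha> j *\<^sub>R u j)"
    using assms by (simp add: avg_iterate_def matrix_vector_mult_scaleR)
  also have "\<dots> = (\<Sum>j\<le>k. \<alpha> j *\<^sub>R (G *v u j))"
    by (simp add: linear_sum[OF matrix_vector_mul_linear] matrix_vector_mult_scaleR)
  finally show ?thesis
    by (simp add: scaleR_add_right sum.distrib scaleR_left.sum)
qed

text \<open>The bound is in terms of \<open>S\<^sub>k\<close>, which the telescoped inequalities produce as the common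
  denominator; \<open>E\<close> collects the errors in feasibility, from below and from above.\<close>

lemma DG_average_error:
  fixes G :: "real ^ 'n ^ 'p"
  assumes pr: "\<sigma> > 0" "strongly_convex \<sigma> f" "convex U"
    and K: "cone K" "closed K" "convex K" "K \<noteq> {}"
    and x0: "x0 \<in> dual_cone K" and DG: "DG_iterates f G g K U x0 \<alpha> x u"
    and a: "\<And>k. 0 < \<alpha> k" "\<And>k. \<alpha> k * lipschitz_dual \<sigma> G \<le> 1"
    and xs: "is_arg_max (dual_fun f G g U) (\<lambda>x. x \<in> dual_cone K) xs"
    and opt: "dual_fun f G g U xs = opt_val f G g K U"
    and E: "2 * norm (x0 - xs) \<le> E" "2 * norm (x0 - xs) * norm xs \<le> E" "(norm x0)\<^sup>2 / 2 \<le> E"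
  shows "primal_solution f G g K U (E / (\<Sum>j\<le>k. \<alpha> j)) (avg_iterate \<alpha> u k)"
proof -
  let ?S = "\<Sum>j\<le>k. \<alpha> j" and ?v = "avg_iterate \<alpha> u k" and ?F = "opt_val f G g K U"
  define r where "r = (1 / ?S) *\<^sub>R (x (Suc k) - x0)"
  have S: "?S > 0"
    by (rule sum_pos) (use a in auto)
  have a0: "\<And>k. 0 \<le> \<alpha> k"
    using a(1) by (simp add: less_imp_le)
  have min: "is_arg_min (\<lambda>v. lagrangian f G g v (x j)) (\<lambda>v. v \<in> U) (u j)" for j
    using DG by (simp add: DG_iterates_def)
  have vU: "?v \<in> U"
    using avg_iterate_in_convex[OF pr(3) _ a0 S] min by (simp add: is_arg_min_def)
  have xsK: "xs \<in> dual_cone K" and max: "\<And>z. z \<in> dual_cone K \<Longrightarrow> dual_fun f G g U z \<le> ?F"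
    using xs opt by (auto simp: is_arg_max_def not_less)

  have "norm (x (Suc k) - x0) \<le> norm (x (Suc k) - xs) + norm (x0 - xs)"
    using norm_triangle_ineq4[of "x (Suc k) - xs" "x0 - xs"] by simp
  hence "norm (x (Suc k) - x0) \<le> 2 * norm (x0 - xs)"
    using DG_iterates_bounded[OF pr x0 DG a0 a(2) xs, of k] by simp
  hence r: "norm r \<le> 2 * norm (x0 - xs) / ?S"
    using S by (simp add: r_def divide_right_mono)

  have "(1 / ?S) *\<^sub>R (x (Suc k) - x0 + ?S *\<^sub>R (G *v ?v + g)) \<in> K"
    unfolding avg_iterate_affine[OF less_imp_neq[OF S, symmetric]]
    using K(1) DG_constraint_sum_in_cone[OF pr K DG, of k] S by (simp add: cone_def)
  \<comment> \<open>The vector \<open>r\<close>, of size of order \<open>1/S\<^sub>k\<close>, repairs the constraint violation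
    of the average; feasibility and the lower bound both follow from this.\<close>
  hence rK: "(G *v ?v + g) + r \<in> K"
    using S by (simp add: r_def scaleR_add_right add.commute)

  have "infdist (G *v ?v + g) K \<le> norm r"
    using infdist_le[OF rK, of "G *v ?v + g"] by (simp add: dist_norm)
  also have "\<dots> \<le> E / ?S"
    using r E(1) S by (meson divide_right_mono less_imp_le order_trans)
  finally have feas: "infdist (G *v ?v + g) K \<le> E / ?S" .

  have "?F \<le> f ?v - xs \<bullet> (G *v ?v + g)"
    using dual_fun_le_lagrangian[OF pr min vU, of xs] opt by (simp add: lagrangian_def)
  moreover have "0 \<le> xs \<bullet> (G *v ?v + g) + xs \<bullet> r"
    using xsK rK by (simp add: dual_cone_def flip: inner_add_right)
  moreover have "xs \<bullet> r \<le> norm xs * (2 * norm (x0 - xs) / ?S)"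
    by (rule order_trans[OF norm_cauchy_schwarz mult_left_mono[OF r norm_ge_zero]])
  moreover have "norm xs * (2 * norm (x0 - xs) / ?S) \<le> E / ?S"
    using E(2) S by (simp add: divide_right_mono mult_ac)
  ultimately have lower: "- (E / ?S) \<le> f ?v - ?F"
    by linarith

  have "?S * f ?v \<le> (\<Sum>j\<le>k. \<alpha> j * f (u j))"
    by (rule avg_iterate_convex_on_le[OF strongly_convex_imp_convex_on[OF less_imp_le[OF pr(1)] pr(2)]
          a0 S])
  moreover have "(norm (x (Suc k)))\<^sup>2 + 2 * (\<Sum>j\<le>k. \<alpha> j * f (u j)) \<le> (norm x0)\<^sup>2 + 2 * ?S * ?F"
    using DG_sum_lagrangian[OF pr x0 DG a0 a(2) zero_in_dual_cone max, of k]
    by (simp add: lagrangian_def)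
  moreover have "0 \<le> (norm (x (Suc k)))\<^sup>2"
    by simp
  ultimately have "?S * f ?v \<le> E + ?S * ?F"
    using E(3) by linarith
  hence "f ?v - ?F \<le> E / ?S"
    using S by (simp add: field_simps)
  with vU feas lower show ?thesis
    by (simp add: primal_solution_def)
qed

lemma primal_solution_mono:
  "primal_solution f G g K U e v \<Longrightarrow> e \<le> e' \<Longrightarrow> primal_solution f G g K U e' v"
  unfolding primal_solution_def by linarith

theorem theorem3p4:
  fixes f :: "real ^ 'n \<Rightarrow> real" and \<sigma> :: real
    and G :: "real ^ 'n ^ 'p" and g :: "real ^ 'p"
    and K :: "(real ^ 'p) set" and U :: "(real ^ 'n) set"
    and x0 :: "real ^ 'p" and LG :: real
  assumes "\<sigma> > 0" and "strongly_convex \<sigma> f"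
    and "G \<noteq> 0"
    and "proper_cone K"
    and "U \<noteq> {}" and "closed U" and "convex U"
    and "feasible_set G g K U \<noteq> {}"
    and "\<exists>xs. is_arg_max (dual_fun f G g U) (\<lambda>x. x \<in> dual_cone K) xs
              \<and> dual_fun f G g U xs = opt_val f G g K U"
    and "x0 \<in> dual_cone K"
    and "LG \<ge> lipschitz_dual \<sigma> G"
  shows "\<exists>C1 > 0. \<exists>C2 > 0.
    \<forall>(\<alpha> :: nat \<Rightarrow> real) (x :: nat \<Rightarrow> real ^ 'p) (u :: nat \<Rightarrow> real ^ 'n).
      (\<forall>k. 1 / LG \<le> \<alpha> k \<and> \<alpha> k \<le> 1 / lipschitz_dual \<sigma> G)
      \<and> DG_iterates f G g K U x0 \<alpha> x u
      \<longrightarrow> (\<forall>\<epsilon> > 0. \<forall>k :: nat. real k \<ge> C1 / \<epsilon> \<longrightarrow>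
            primal_solution f G g K U (C2 * \<epsilon>) (avg_iterate \<alpha> u k))"
proof -
  let ?L = "lipschitz_dual \<sigma> G"
  obtain xs where xs: "is_arg_max (dual_fun f G g U) (\<lambda>x. x \<in> dual_cone K) xs"
    and opt: "dual_fun f G g U xs = opt_val f G g K U"
    using assms(9) by blast
  have K: "cone K" "closed K" "convex K" "K \<noteq> {}"
    using assms(4) by (auto simp: proper_cone_def)
  have L: "?L > 0"
    by (rule lipschitz_dual_pos[OF assms(1,3)])
  hence LG: "LG > 0"
    using assms(11) by simp
  \<comment> \<open>The last summand makes the constant positive even if the other errors vanish.\<close>
  define E where "E = 2 * norm (x0 - xs) + 2 * norm (x0 - xs) * norm xs + (norm x0)\<^sup>2 / 2 + 1"
  have E: "2 * norm (x0 - xs) \<le> E" "2 * norm (x0 - xs) * norm xs \<le> E" "(norm x0)\<^sup>2 / 2 \<le> E" "E > 0"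
    unfolding E_def by (simp_all add: add_nonneg_pos add_increasing)
  have "primal_solution f G g K U (E * LG * \<epsilon>) (avg_iterate \<alpha> u k)"
    if step: "\<And>k. 1 / LG \<le> \<alpha> k \<and> \<alpha> k \<le> 1 / ?L" and DG: "DG_iterates f G g K U x0 \<alpha> x u"
      and \<epsilon>: "\<epsilon> > 0" and k: "real k \<ge> 1 / \<epsilon>"
    for \<alpha> :: "nat \<Rightarrow> real" and x :: "nat \<Rightarrow> real ^ 'p" and u :: "nat \<Rightarrow> real ^ 'n"
      and \<epsilon> :: real and k :: nat
  proof -
    have a: "0 < \<alpha> j" "\<alpha> j * ?L \<le> 1" for j
    proof -
      show "0 < \<alpha> j"
        using step[of j] LG by (meson less_le_trans zero_less_divide_1_iff)
      show "\<alpha> j * ?L \<le> 1"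
        using step[of j] L by (simp add: field_simps)
    qed
    have "real (Suc k) * (1 / LG) \<le> (\<Sum>j\<le>k. \<alpha> j)"
      using sum_bounded_below[of "{..k}" "1 / LG" \<alpha>] step by simp
    moreover have "1 / (LG * \<epsilon>) \<le> real (Suc k) * (1 / LG)"
      using k LG \<epsilon> by (simp add: field_simps)
    ultimately have S: "1 / (LG * \<epsilon>) \<le> (\<Sum>j\<le>k. \<alpha> j)"
      by simp
    have "E / (\<Sum>j\<le>k. \<alpha> j) \<le> E / (1 / (LG * \<epsilon>))"
      by (rule frac_le) (use E(4) LG \<epsilon> S in simp_all)
    hence "E / (\<Sum>j\<le>k. \<alpha> j) \<le> E * LG * \<epsilon>"
      by (simp add: mult.assoc)
    with DG_average_error[OF assms(1,2,7) K assms(10) DG a xs opt E(1-3)] show ?thesis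
      by (rule primal_solution_mono)
  qed
  moreover have "E * LG > 0"
    using E(4) LG by simp
  ultimately show ?thesis
    by (intro exI[of _ "1::real"] exI[of _ "E * LG"]) auto
qed

end
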